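(* Let $G$ be a connected graph on $n\ge 2$ vertices, let $k\ge 1$, and let $G^k$ be a graph obtained by adding $k$ pendant vertices to $G$. Then $$b(G^k)\le b(G)\prod_{i=0}^{k-1}\left(1-\frac{1}{(n+i)^2}\right).$$
   Context: Graphs are finite, simple, undirected and unweighted. For a graph $G$ with vertex set $V(G)$, $|V(G)|\ge 2$, and edge set $E(G)$, the $\ell_1$-Fiedler value is $$b(G)=\min\Big\{\sum_{uv\in E(G)}|x_u-x_v| : x\in\mathbb{R}^{V(G)},\ \sum_{v\in V(G)}x_v=0,\ \sum_{v\in V(G)}|x_v|=1\Big\}.$$ Adding a pendant vertex to a graph means adding one new vertex joined by a single edge to exactly one existing vertex; $G^k$ is obtained by performing this operation $k$ times successively, with arbitrary choices of attachment vertices. *)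

theory Defs
  imports "HOL-Analysis.Analysis"
begin

text \<open>A graph is given by its vertex set \<open>V\<close> and its edge set \<open>E\<close>, an edge being an
  unordered pair of distinct vertices, that is, a two-element subset of \<open>V\<close>.\<close>

definition simple_graph :: "'a set \<Rightarrow> 'a set set \<Rightarrow> bool" where
  "simple_graph V E \<longleftrightarrow> finite V \<and> E \<subseteq> {{u, v} | u v. u \<in> V \<and> v \<in> V \<and> u \<noteq> v}"

definition connected_graph :: "'a set \<Rightarrow> 'a set set \<Rightarrow> bool" where
  "connected_graph V E \<longleftrightarrow>
     simple_graph V E \<and> V \<noteq> {} \<and> (\<forall>u\<in>V. \<forall>v\<in>V. (u, v) \<in> {(a, b). {a, b} \<in> E}\<^sup>*)"

text \<open>The term \<open>\<bar>x u - x v\<bar>\<close> as a function of the unordered pair \<open>{u, v}\<close>; it does not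
  depend on the order of \<open>u\<close> and \<open>v\<close>, see the lemma below.\<close>

definition edge_diff :: "('a \<Rightarrow> real) \<Rightarrow> 'a set \<Rightarrow> real" where
  "edge_diff x e = (THE d. \<exists>u v. e = {u, v} \<and> d = \<bar>x u - x v\<bar>)"

lemma edge_diff_pair [simp]: "edge_diff x {u, v} = \<bar>x u - x v\<bar>"
  unfolding edge_diff_def
  by (rule the_equality) (auto simp: doubleton_eq_iff abs_minus_commute)

definition l1_energy :: "'a set set \<Rightarrow> ('a \<Rightarrow> real) \<Rightarrow> real" where
  "l1_energy E x = (\<Sum>e\<in>E. edge_diff x e)"

text \<open>Vectors in \<open>\<real>\<^sup>V\<close> are functions on the whole type; the values outside \<open>V\<close> are irrelevant.\<close>

definition l1_feasible :: "'a set \<Rightarrow> ('a \<Rightarrow> real) set" where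
  "l1_feasible V = {x. (\<Sum>v\<in>V. x v) = 0 \<and> (\<Sum>v\<in>V. \<bar>x v\<bar>) = 1}"

text \<open>The minimum of the energy over the feasible vectors. It is attained as soon as
  \<open>card V \<ge> 2\<close>, see \<open>l1_fiedler_attained\<close>.\<close>

definition l1_fiedler :: "'a set \<Rightarrow> 'a set set \<Rightarrow> real" where
  "l1_fiedler V E = (LEAST r. r \<in> l1_energy E ` l1_feasible V)"

inductive add_pendants ::
  "'a set \<Rightarrow> 'a set set \<Rightarrow> nat \<Rightarrow> 'a set \<Rightarrow> 'a set set \<Rightarrow> bool" for V E where
  none: "add_pendants V E 0 V E"
| pendant: "add_pendants V E k V' E' \<Longrightarrow> u \<in> V' \<Longrightarrow> w \<notin> V' \<Longrightarrow>
    add_pendants V E (Suc k) (insert w V') (insert {u, w} E')"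

lemma l1_energy_attains_min:
  assumes G: "simple_graph V E" and card: "card V \<ge> 2"
  shows "\<exists>x\<in>l1_feasible V. \<forall>y\<in>l1_feasible V. l1_energy E x \<le> l1_energy E y"
proof -
  have fin: "finite V" and E: "\<And>e. e \<in> E \<Longrightarrow> \<exists>u\<in>V. \<exists>v\<in>V. u \<noteq> v \<and> e = {u, v}"
    using G unfolding simple_graph_def by blast+
  define K where "K = Pi\<^sub>E UNIV (\<lambda>v. if v \<in> V then {-1..1} else {0::real})"
  have "compact K"
  proof -
    have "compactin (product_topology (\<lambda>_. euclidean) UNIV) K"
      unfolding K_def by (subst compactin_PiE) auto
    then show ?thesis by (simp add: euclidean_product_topology)
  qed
  have c1: "continuous_on UNIV (\<lambda>x. \<Sum>v\<in>V. x v :: real)"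
    and c2: "continuous_on UNIV (\<lambda>x. \<Sum>v\<in>V. \<bar>x v :: real\<bar>)"
    by (intro continuous_intros continuous_on_product_coordinates)+
  have "closed ((\<lambda>x. \<Sum>v\<in>V. x v) -` {0::real})" "closed ((\<lambda>x. \<Sum>v\<in>V. \<bar>x v\<bar>) -` {1::real})"
    by (rule closed_vimage[OF closed_singleton]; fact)+
  then have "closed (l1_feasible V)"
    by (simp add: l1_feasible_def vimage_def Collect_conj_eq closed_Int)
  with \<open>compact K\<close> have comp: "compact (K \<inter> l1_feasible V)"
    by (rule compact_Int_closed)
  have ene: "l1_energy E x = l1_energy E y" if "\<And>v. v \<in> V \<Longrightarrow> x v = y v" for x y
    unfolding l1_energy_def
  proof (rule sum.cong)
    fix e assume "e \<in> E"
    then obtain u v where "u \<in> V" "v \<in> V" "e = {u, v}" using E by blast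
    then show "edge_diff x e = edge_diff y e" using that by simp
  qed simp
  have cont: "continuous_on (K \<inter> l1_feasible V) (l1_energy E)"
  proof -
    have "continuous_on UNIV (\<lambda>x. edge_diff x e)" if e: "e \<in> E" for e
    proof -
      obtain u v where "e = {u, v}" using E[OF e] by blast
      then show ?thesis
        by (auto intro!: continuous_intros continuous_on_product_coordinates)
    qed
    then have "continuous_on UNIV (l1_energy E)"
      unfolding l1_energy_def[abs_def] by (intro continuous_on_sum)
    then show ?thesis by (rule continuous_on_subset) simp
  qed
  have restr: "\<exists>y\<in>K \<inter> l1_feasible V. l1_energy E y = l1_energy E x" if "x \<in> l1_feasible V" for x
  proof
    let ?y = "\<lambda>v. if v \<in> V then x v else 0"
    show "l1_energy E ?y = l1_energy E x" by (rule ene) simp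
    have *: "(\<Sum>v\<in>V. x v) = 0" "(\<Sum>v\<in>V. \<bar>x v\<bar>) = 1"
      using that by (auto simp: l1_feasible_def)
    have "\<bar>x v\<bar> \<le> 1" if "v \<in> V" for v
      using member_le_sum[OF that, of "\<lambda>v. \<bar>x v\<bar>"] fin * by auto
    then have "?y \<in> K" by (auto simp: K_def abs_le_iff)
    moreover have "?y \<in> l1_feasible V"
      using * by (simp add: l1_feasible_def cong: sum.cong)
    ultimately show "?y \<in> K \<inter> l1_feasible V" by simp
  qed
  obtain a b where ab: "a \<in> V" "b \<in> V" "a \<noteq> b"
    using card by (metis card_le_Suc0_iff_eq fin not_less_eq_eq numeral_2_eq_2)
  define z where "z = (\<lambda>v. if v = a then 1/2 else if v = b then -1/2 else (0::real))"
  have "sum z V = sum z {a, b}" "(\<Sum>v\<in>V. \<bar>z v\<bar>) = (\<Sum>v\<in>{a, b}. \<bar>z v\<bar>)"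
    by (rule sum.mono_neutral_right; use ab fin in \<open>auto simp: z_def\<close>)+
  then have "z \<in> l1_feasible V" using ab by (simp add: l1_feasible_def z_def)
  then have "K \<inter> l1_feasible V \<noteq> {}" using restr by blast
  from continuous_attains_inf[OF comp this cont] show ?thesis
    using restr by (metis IntD2)
qed

lemma l1_fiedler_attained:
  assumes "simple_graph V E" and "card V \<ge> 2"
  shows "\<exists>x\<in>l1_feasible V. l1_fiedler V E = l1_energy E x"
    and "\<And>y. y \<in> l1_feasible V \<Longrightarrow> l1_fiedler V E \<le> l1_energy E y"
proof -
  obtain x where x: "x \<in> l1_feasible V" "\<forall>y\<in>l1_feasible V. l1_energy E x \<le> l1_energy E y"
    using l1_energy_attains_min[OF assms] by blast
  then have eq: "l1_fiedler V E = l1_energy E x"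
    unfolding l1_fiedler_def by (intro Least_equality) auto
  show "\<exists>x\<in>l1_feasible V. l1_fiedler V E = l1_energy E x" using x eq by blast
  show "l1_fiedler V E \<le> l1_energy E y" if "y \<in> l1_feasible V" for y
    using x eq that by simp
qed

end

theory Submission
  imports Defs
begin

text \<open>The vector \<open>\<one>\<^sub>T / (2 |T|) - \<one>\<^sub>U / (2 |U|)\<close>, with \<open>U\<close> the complement of \<open>T\<close>, is feasible and
  bounds \<open>b\<close> above by \<open>N |\<partial>T| / (2 |T| |U|)\<close> on a graph with \<open>N\<close> vertices. Conversely, by
  integrating over the level sets \<open>{v. x\<^sub>v > t}\<close> (coarea formula), an inequality
  \<open>n |\<partial>S| \<ge> 2 M |S| (n - |S|)\<close> valid for all \<open>S\<close> gives \<open>b \<ge> M\<close>. When a pendant vertex is put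
  on the side of \<open>S\<close> that contains its neighbour, the cut \<open>\<partial>S\<close> does not change and that side
  grows from some \<open>s \<le> n - 1\<close> to \<open>s + 1\<close> vertices, so the ratio changes by the factor
  \<open>(n + 1) s / (n (s + 1)) \<le> 1 - 1 / n\<^sup>2\<close>.\<close>

lemma simple_graph_edgeE:
  assumes "simple_graph V E" and "e \<in> E"
  obtains u v where "u \<in> V" "v \<in> V" "e = {u, v}"
  using assms unfolding simple_graph_def by blast

lemma l1_energy_nonneg:
  assumes "simple_graph V E"
  shows "0 \<le> l1_energy E x"
  unfolding l1_energy_def
  by (rule sum_nonneg) (use assms in \<open>auto elim!: simple_graph_edgeE\<close>)

lemma l1_fiedler_nonneg:
  assumes "simple_graph V E" and "card V \<ge> 2"
  shows "0 \<le> l1_fiedler V E"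
  using l1_fiedler_attained(1)[OF assms] l1_energy_nonneg[OF assms(1)] by fastforce

text \<open>\<open>l1_energy E (indicator T)\<close> is the size of the cut around \<open>T\<close>.
  Denominators are cleared so that \<open>T = {}\<close> and \<open>T = V\<close>, where the left
  side vanishes, are covered too.\<close>

lemma l1_fiedler_le_cut:
  assumes G: "simple_graph V E" and card: "card V \<ge> 2" and T: "T \<subseteq> V"
  shows "l1_fiedler V E * (2 * real (card T) * (real (card V) - real (card T)))
    \<le> real (card V) * l1_energy E (indicator T)"
proof (cases "T = {} \<or> T = V")
  case True
  then show ?thesis
    using l1_energy_nonneg[OF G] by auto
next
  case False
  have fin: "finite V" using G by (simp add: simple_graph_def)
  define s r where "s = real (card T)" and "r = real (card (V - T))"
  have r: "r = real (card V) - s"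
    using T fin by (simp add: r_def s_def card_Diff_subset finite_subset card_mono of_nat_diff)
  have pos: "s > 0" "r > 0"
    using False T fin by (auto simp: s_def r_def card_gt_0_iff finite_subset)
  define y :: "'a \<Rightarrow> real" where "y v = (if v \<in> T then 1 / (2 * s) else - 1 / (2 * r))" for v
  have split: "(\<Sum>v\<in>V. g v) = (\<Sum>v\<in>T. g v) + (\<Sum>v\<in>V - T. g v)" for g :: "'a \<Rightarrow> real"
    using sum.subset_diff[OF T fin, of g] by simp
  have "y \<in> l1_feasible V"
    using pos by (simp add: l1_feasible_def split y_def flip: s_def r_def)
  then have "l1_fiedler V E \<le> l1_energy E y"
    by (rule l1_fiedler_attained(2)[OF G card])
  \<comment> \<open>On \<open>V\<close>, \<open>y\<close> is
    \<open>1 / (2 * s) + 1 / (2 * r)\<close> times the indicator of \<open>T\<close>, shifted by the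
    constant \<open>- 1 / (2 * r)\<close>; the shift cancels in differences.\<close>
  also have "l1_energy E y = (1 / (2 * s) + 1 / (2 * r)) * l1_energy E (indicator T)"
    unfolding l1_energy_def sum_distrib_left
  proof (rule sum.cong[OF refl])
    fix e assume "e \<in> E"
    with G obtain u v where "e = {u, v}" by (rule simple_graph_edgeE)
    then show "edge_diff y e = (1 / (2 * s) + 1 / (2 * r)) * edge_diff (indicator T) e"
      using pos abs_minus_cancel[of "1 / (2 * r) + 1 / (2 * s)"]
      by (simp add: y_def indicator_def)
  qed
  also have "\<dots> = real (card V) * l1_energy E (indicator T) / (2 * s * r)"
    using pos r by (simp add: field_simps)
  finally show ?thesis
    using pos by (simp add: pos_le_divide_eq r flip: s_def)
qed

text \<open>One-edge case of the coarea formula: for \<open>a \<le> b\<close> the integrand is 1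
  exactly on the half-open interval from \<open>a\<close> to \<open>b\<close>.\<close>

lemma has_integral_level_set_diff:
  fixes a b :: real
  shows "((\<lambda>t. \<bar>indicator {t<..} a - indicator {t<..} b\<bar>) has_integral \<bar>a - b\<bar>) UNIV"
proof -
  have "((\<lambda>t. \<bar>indicator {t<..} a - indicator {t<..} b\<bar>) has_integral b - a) UNIV"
    if "a \<le> b" for a b :: real
  proof -
    have "((\<lambda>t. 1) has_integral b - a) {a..b}"
      using has_integral_const_real[of "1::real" a b] that by simp
    then have "((\<lambda>t. if t \<in> {a..b} then 1 else 0) has_integral b - a) UNIV"
      by (simp only: has_integral_restrict_UNIV)
    then show ?thesis
      \<comment> \<open>At \<open>t = b\<close> both indicators vanish, the only point where the
        integrand differs from the indicator of \<open>{a..b}\<close>.\<close>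
      by (rule has_integral_spike_finite[of "{b}", rotated -1]) (use that in \<open>auto simp: indicator_def\<close>)
  qed
  from this[of a b] this[of b a] show ?thesis
    by (cases "a \<le> b") (simp_all add: abs_minus_commute)
qed

text \<open>Only pairs separated by \<open>S\<close> contribute, and each is counted in both orders,
  hence the factor 2.\<close>

lemma sum_indicator_diff:
  assumes fin: "finite V" and S: "S \<subseteq> V"
  shows "(\<Sum>u\<in>V. \<Sum>v\<in>V. \<bar>indicator S u - indicator S v\<bar>)
    = 2 * real (card S) * (real (card V) - real (card S))"
proof -
  have split: "(\<Sum>v\<in>V. g v) = (\<Sum>v\<in>S. g v) + (\<Sum>v\<in>V - S. g v)" for g :: "'a \<Rightarrow> real"
    using sum.subset_diff[OF S fin, of g] by simp
  have "real (card (V - S)) = real (card V) - real (card S)"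
    using S fin by (simp add: card_Diff_subset finite_subset card_mono of_nat_diff)
  then show ?thesis
    by (simp add: split)
qed

text \<open>The sum of \<open>\<bar>x u - x v\<bar>\<close> over ordered pairs mediates. On level
  sets it is the quantity multiplying \<open>M\<close> in the cut hypothesis, which therefore
  integrates to a bound on this sum; feasibility makes the sum at least
  \<open>card V\<close>.\<close>

lemma cut_bound_imp_energy_bound:
  assumes G: "simple_graph V E" and "V \<noteq> {}" and M: "M \<ge> 0"
    and cut: "\<And>S. S \<subseteq> V \<Longrightarrow>
      M * (2 * real (card S) * (real (card V) - real (card S)))
        \<le> real (card V) * l1_energy E (indicator S)"
    and x: "x \<in> l1_feasible V"
  shows "M \<le> l1_energy E x"
proof -
  have fin: "finite V" using G by (simp add: simple_graph_def)
  have "finite E"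
    by (rule finite_subset[of _ "Pow V"]) (use G fin in \<open>auto simp: simple_graph_def\<close>)
  define S where "S t = {v \<in> V. t < x v}" for t
  have ind: "indicator (S t) v = (indicator {t<..} (x v) :: real)" if "v \<in> V" for t v
    using that by (simp add: S_def indicator_def)
  have pairs: "((\<lambda>t. \<Sum>u\<in>V. \<Sum>v\<in>V. \<bar>indicator (S t) u - indicator (S t) v\<bar>)
      has_integral (\<Sum>u\<in>V. \<Sum>v\<in>V. \<bar>x u - x v\<bar>)) UNIV"
    by (intro has_integral_sum fin) (simp add: ind has_integral_level_set_diff)
  have energy: "((\<lambda>t. l1_energy E (indicator (S t))) has_integral l1_energy E x) UNIV"
    unfolding l1_energy_def
  proof (intro has_integral_sum \<open>finite E\<close>)
    fix e assume "e \<in> E"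
    with G obtain u v where "u \<in> V" "v \<in> V" "e = {u, v}" by (rule simple_graph_edgeE)
    then show "((\<lambda>t. edge_diff (indicator (S t)) e) has_integral edge_diff x e) UNIV"
      by (simp add: ind has_integral_level_set_diff)
  qed
  have "M * (\<Sum>u\<in>V. \<Sum>v\<in>V. \<bar>x u - x v\<bar>) \<le> real (card V) * l1_energy E x"
  proof (rule has_integral_le)
    show "((\<lambda>t. M * (\<Sum>u\<in>V. \<Sum>v\<in>V. \<bar>indicator (S t) u - indicator (S t) v\<bar>))
        has_integral M * (\<Sum>u\<in>V. \<Sum>v\<in>V. \<bar>x u - x v\<bar>)) UNIV"
      by (rule has_integral_mult_right[OF pairs])
    show "((\<lambda>t. real (card V) * l1_energy E (indicator (S t)))
        has_integral real (card V) * l1_energy E x) UNIV"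
      by (rule has_integral_mult_right[OF energy])
    show "M * (\<Sum>u\<in>V. \<Sum>v\<in>V. \<bar>indicator (S t) u - indicator (S t) v\<bar>)
        \<le> real (card V) * l1_energy E (indicator (S t))" for t
      using cut[of "S t"] fin by (simp add: sum_indicator_diff S_def)
  qed
  moreover have "real (card V) \<le> (\<Sum>u\<in>V. \<Sum>v\<in>V. \<bar>x u - x v\<bar>)"
  proof -
    \<comment> \<open>As \<open>x\<close> sums to 0, the inner sum is \<open>card V * x u\<close>;
      the absolute values of \<open>x\<close> sum to 1.\<close>
    have "real (card V) = (\<Sum>u\<in>V. \<bar>\<Sum>v\<in>V. x u - x v\<bar>)"
      using x by (simp add: l1_feasible_def sum_subtractf abs_mult flip: sum_distrib_left)
    also have "\<dots> \<le> (\<Sum>u\<in>V. \<Sum>v\<in>V. \<bar>x u - x v\<bar>)"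
      by (intro sum_mono sum_abs)
    finally show ?thesis .
  qed
  ultimately have "M * real (card V) \<le> real (card V) * l1_energy E x"
    using M by (meson mult_left_mono order_trans)
  then show ?thesis
    using \<open>V \<noteq> {}\<close> fin by (simp add: card_gt_0_iff mult.commute[of M])
qed

lemma simple_graph_add_pendant:
  assumes "simple_graph V E" and "u \<in> V" and "w \<notin> V"
  shows "simple_graph (insert w V) (insert {u, w} E)"
  using assms unfolding simple_graph_def by blast

lemma l1_fiedler_add_pendant:
  assumes G: "simple_graph V E" and card: "card V \<ge> 2" and u: "u \<in> V" and w: "w \<notin> V"
  shows "l1_fiedler (insert w V) (insert {u, w} E)
    \<le> l1_fiedler V E * (1 - 1 / (real (card V))\<^sup>2)"
proof -
  have fin: "finite V" using G by (simp add: simple_graph_def)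
  have "finite E"
    by (rule finite_subset[of _ "Pow V"]) (use G fin in \<open>auto simp: simple_graph_def\<close>)
  have "{u, w} \<notin> E" using G w by (auto simp: doubleton_eq_iff elim: simple_graph_edgeE)
  have G': "simple_graph (insert w V) (insert {u, w} E)"
    using G u w by (rule simple_graph_add_pendant)
  have card': "card (insert w V) = card V + 1" using fin w by simp
  define n b where "n = real (card V)" and "b = l1_fiedler (insert w V) (insert {u, w} E)"
  have n: "n \<ge> 2" using card by (simp add: n_def)
  have b: "b \<ge> 0" unfolding b_def using G' card card' by (intro l1_fiedler_nonneg) auto
  have n2: "n\<^sup>2 - 1 > 0" using power_mono[of 2 n 2] n by simp
  \<comment> \<open>\<open>M\<close> is \<open>b\<close> divided by the target factor
    \<open>1 - 1 / n^2\<close>, so the claim becomes \<open>M \<le> l1_fiedler V E\<close>, which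
    the cut criterion can deliver.\<close>
  define M where "M = b * n\<^sup>2 / (n\<^sup>2 - 1)"
  have "M \<le> l1_energy E x" if "x \<in> l1_feasible V" for x
  proof (rule cut_bound_imp_energy_bound[OF G _ _ _ that])
    show "V \<noteq> {}" using u by auto
    show "M \<ge> 0" using b n2 by (simp add: M_def)
    fix S assume S: "S \<subseteq> V"
    define s c where "s = real (card S)" and "c = l1_energy E (indicator S)"
    define T where "T = (if u \<in> S then insert w S else S)"
    have cardT: "real (card T) = (if u \<in> S then s + 1 else s)"
      using S w fin by (auto simp: T_def s_def finite_subset card_insert_if)
    have "T \<subseteq> insert w V" using S by (auto simp: T_def)
    have "l1_energy (insert {u, w} E) (indicator T) = l1_energy E (indicator T)"
      using \<open>finite E\<close> \<open>{u, w} \<notin> E\<close> S w by (auto simp: l1_energy_def T_def indicator_def)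
    also have "\<dots> = c"
      unfolding c_def l1_energy_def
    proof (rule sum.cong[OF refl])
      fix e assume "e \<in> E"
      with G obtain p q where "p \<in> V" "q \<in> V" "e = {p, q}" by (rule simple_graph_edgeE)
      then show "edge_diff (indicator T) e = edge_diff (indicator S) e"
        using w by (auto simp: T_def indicator_def)
    qed
    finally have bound: "b * (2 * real (card T) * (n + 1 - real (card T))) \<le> (n + 1) * c"
      using l1_fiedler_le_cut[OF G' _ \<open>T \<subseteq> insert w V\<close>] card card'
      by (simp add: b_def n_def add.commute)
    have s: "0 \<le> s" "s \<le> n"
      using S fin by (simp_all add: s_def n_def card_mono)
    \<comment> \<open>Right minus left is \<open>(n - s) * (n - 1 - s)\<close> if
      \<open>u \<in> S\<close> and \<open>s * (s - 1)\<close> otherwise. Both are nonnegative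
      because \<open>s\<close> and \<open>n\<close> are integers with
      \<open>0 \<le> s \<le> n\<close>.\<close>
    have ratio: "n * (s * (n - s)) \<le> (n - 1) * (real (card T) * (n + 1 - real (card T)))"
    proof (cases "u \<in> S")
      case True
      have "0 \<le> (n - s) * (n - 1 - s)"
      proof (cases "S = V")
        case False
        then have "card S < card V" using S fin by (simp add: psubset_card_mono psubsetI)
        then show ?thesis by (simp add: s_def n_def)
      qed (simp add: s_def n_def)
      then show ?thesis using True cardT by (simp add: algebra_simps)
    next
      case False
      have "0 \<le> s * (s - 1)"
        by (cases "card S") (simp_all add: s_def)
      then show ?thesis using False cardT by (simp add: algebra_simps)
    qed
    \<comment> \<open>The factor \<open>n - 1\<close> from \<open>ratio\<close> and the factor
      \<open>n + 1\<close> from \<open>bound\<close> combine to \<open>n^2 - 1\<close>, the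
      denominator of \<open>M\<close>.\<close>
    have "b * n\<^sup>2 * (2 * s * (n - s)) = 2 * b * n * (n * (s * (n - s)))"
      by (simp add: power2_eq_square)
    also have "\<dots> \<le> 2 * b * n * ((n - 1) * (real (card T) * (n + 1 - real (card T))))"
      by (rule mult_left_mono[OF ratio]) (use b n in simp)
    also have "\<dots> = n * (n - 1) * (b * (2 * real (card T) * (n + 1 - real (card T))))"
      by simp
    also have "\<dots> \<le> n * (n - 1) * ((n + 1) * c)"
      by (rule mult_left_mono[OF bound]) (use n in simp)
    also have "\<dots> = n * c * (n\<^sup>2 - 1)"
      by (simp add: power2_eq_square algebra_simps)
    finally show "M * (2 * real (card S) * (real (card V) - real (card S)))
        \<le> real (card V) * l1_energy E (indicator S)"
      using n2 by (simp add: M_def pos_divide_le_eq flip: n_def s_def c_def)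
  qed
  then have "M \<le> l1_fiedler V E"
    using l1_fiedler_attained(1)[OF G card] by auto
  then have "b * n\<^sup>2 \<le> l1_fiedler V E * (n\<^sup>2 - 1)"
    using n2 by (simp add: M_def pos_divide_le_eq)
  then show ?thesis
    using n by (simp add: field_simps flip: n_def b_def)
qed

text \<open>Simplicity and the vertex count are carried through the induction: the single step
  requires the one, and its factor depends on the other.\<close>

lemma l1_fiedler_add_pendants:
  assumes "add_pendants V E k V' E'" and "simple_graph V E" and "card V \<ge> 2"
  shows "simple_graph V' E' \<and> card V' = card V + k
    \<and> l1_fiedler V' E' \<le> l1_fiedler V E * (\<Prod>i<k. 1 - 1 / (real (card V) + real i)\<^sup>2)"
  using assms(1)
proof induction
  case none
  then show ?case using assms by simp
next
  case (pendant k V' E' u w)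
  let ?f = "\<lambda>i. 1 - 1 / (real (card V) + real i)\<^sup>2"
  from pendant have G: "simple_graph V' E'" and card: "card V' = card V + k"
    and le: "l1_fiedler V' E' \<le> l1_fiedler V E * (\<Prod>i<k. ?f i)" by auto
  \<comment> \<open>The new factor must be nonnegative for the induction hypothesis to be multiplied
    by it.\<close>
  have "1 \<le> (real (card V) + real k)\<^sup>2"
    using assms(3) by (intro one_le_power) simp
  then have "0 \<le> ?f k" by (simp add: divide_le_eq_1)
  have "l1_fiedler (insert w V') (insert {u, w} E') \<le> l1_fiedler V' E' * ?f k"
    using l1_fiedler_add_pendant[OF G _ pendant.hyps(2,3)] assms(3) card by simp
  also have "\<dots> \<le> l1_fiedler V E * (\<Prod>i<k. ?f i) * ?f k"
    using le \<open>0 \<le> ?f k\<close> by (rule mult_right_mono)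
  finally have "l1_fiedler (insert w V') (insert {u, w} E')
      \<le> l1_fiedler V E * (\<Prod>i<Suc k. ?f i)"
    by (simp add: mult.assoc)
  moreover have "finite V'" using G by (simp add: simple_graph_def)
  ultimately show ?case
    using simple_graph_add_pendant[OF G pendant.hyps(2,3)] pendant.hyps(3) card by simp
qed

theorem theorem6p3:
  fixes V V' :: "'a set" and E E' :: "'a set set" and n k :: nat
  assumes "connected_graph V E"
    and "card V = n" and "n \<ge> 2"
    and "k \<ge> 1"
    and "add_pendants V E k V' E'"
  shows "l1_fiedler V' E' \<le> l1_fiedler V E * (\<Prod>i=0..k-1. 1 - 1 / (real n + real i)^2)"
proof -
  \<comment> \<open>Subtraction on \<open>nat\<close> is truncated: at \<open>k = 0\<close> the left
    set would be \<open>{0}\<close> and the right one empty.\<close>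
  have "{0..k-1} = {..<k}" using assms(4) by auto
  moreover have "simple_graph V E" using assms(1) by (simp add: connected_graph_def)
  ultimately show ?thesis
    using l1_fiedler_add_pendants[OF assms(5)] assms(2,3) by simp
qed

end
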